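(* Let $G$ and $H$ be graphs with $|V(G)| \ge 2$, $|V(H)| \ge 2$, and $|E(G)| + |E(H)| \ge 1$. Then $F(G \vee H) = \alpha(G \vee H)$.
   Context: Peg solitaire on a graph: a configuration assigns to each vertex either a peg or a hole. If $x,y,z$ form a path $xyz$ with pegs at $x$ and $y$ and a hole at $z$, a jump $xyz$ removes the pegs at $x$ and $y$ and places a peg at $z$. A terminal state of a graph $G$ is the set of peg locations when no jump is available, reached by some sequence of jumps from a starting configuration with exactly one hole (and pegs on all other vertices). The fool's solitaire number $F(G)$ is the maximum size of a terminal state of $G$. $\alpha(G)$ is the independence number. The join $G \vee H$ is obtained from the disjoint union of $G$ and $H$ by adding all edges between $V(G)$ and $V(H)$. *)

theory Defs
  imports "Graph_Theory.Pair_Digraph"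
begin

text \<open>
  A finite simple graph is a \<^locale>\<open>pair_graph\<close>: an undirected edge \<open>{u, v}\<close> is represented
  by the two arcs \<open>(u, v)\<close> and \<open>(v, u)\<close>, so \<^const>\<open>parcs\<close> has twice as many elements as the
  edge set.
\<close>

definition edge_set :: "'a pair_pre_digraph \<Rightarrow> 'a set set" where
  "edge_set G = {{u, v} |u v. (u, v) \<in> parcs G}"

definition graph_join ::
    "'a pair_pre_digraph \<Rightarrow> 'b pair_pre_digraph \<Rightarrow> ('a + 'b) pair_pre_digraph" where
  "graph_join G H =
     \<lparr> pverts = pverts G <+> pverts H,
       parcs = map_prod Inl Inl ` parcs G \<union> map_prod Inr Inr ` parcs H
         \<union> (Inl ` pverts G) \<times> (Inr ` pverts H) \<union> (Inr ` pverts H) \<times> (Inl ` pverts G) \<rparr>"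

definition independent_set :: "'a pair_pre_digraph \<Rightarrow> 'a set \<Rightarrow> bool" where
  "independent_set G S \<longleftrightarrow> S \<subseteq> pverts G \<and> (\<forall>u\<in>S. \<forall>v\<in>S. (u, v) \<notin> parcs G)"

definition independence_number :: "'a pair_pre_digraph \<Rightarrow> nat" where
  "independence_number G = Max {card S |S. independent_set G S}"

text \<open>
  A configuration is given by its set of pegs; the remaining vertices of the graph are holes.
  In a loopfree graph the conditions on a jump force \<open>x\<close>, \<open>y\<close>, \<open>z\<close> to be distinct.
\<close>

inductive jump :: "'a pair_pre_digraph \<Rightarrow> 'a set \<Rightarrow> 'a set \<Rightarrow> bool" for G where
  "\<lbrakk>(x, y) \<in> parcs G; (y, z) \<in> parcs G; x \<in> P; y \<in> P; z \<notin> P\<rbrakk>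
     \<Longrightarrow> jump G P (insert z (P - {x, y}))"

definition terminal_state :: "'a pair_pre_digraph \<Rightarrow> 'a set \<Rightarrow> bool" where
  "terminal_state G T \<longleftrightarrow>
     (\<exists>v\<in>pverts G. (jump G)\<^sup>*\<^sup>* (pverts G - {v}) T) \<and> (\<nexists>P. jump G T P)"

definition fools_solitaire_number :: "'a pair_pre_digraph \<Rightarrow> nat" where
  "fools_solitaire_number G = Max {card T |T. terminal_state G T}"

end

theory Submission
  imports Defs
begin

text \<open>
  Complementation turns a jump sequence around, so \<open>S\<close> is reachable from a single hole iff the
  pegs on the complement of \<open>S\<close> can be reduced to a single peg. In a join, jumping from a peg of
  one side over any peg of the other side into a hole of the first removes the second peg and
  keeps the number of pegs on the first side; such jumps reduce the complement of every nonempty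
  independent set to one peg, except that one jump along an edge inside a side is needed first
  when the set is an entire side. Conversely, a terminal state with two adjacent pegs would fill
  a connected graph. Hence the nonempty terminal states of a join are exactly its nonempty
  independent sets.
\<close>

section \<open>Jumps and complementation\<close>

lemma (in pair_graph) jump_subset:
  assumes "jump G P Q" "P \<subseteq> pverts G"
  shows "Q \<subset> pverts G"
  using assms(1)
proof cases
  case (1 x y z)
  then have "x \<notin> Q" "x \<in> pverts G" "z \<in> pverts G"
    using assms(2) in_arcsD2 by auto
  then show ?thesis
    using 1 assms(2) by blast
qed

lemma (in pair_graph) jumps_psubset:
  assumes "(jump G)\<^sup>*\<^sup>* P Q" "P \<subset> pverts G"
  shows "Q \<subset> pverts G"
  using assms by induction (auto dest: jump_subset)

text \<open>After the jump \<open>x\<close> and \<open>y\<close> are holes and \<open>z\<close> is a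
  peg, so with pegs and holes exchanged the same path \<open>x\<close>, \<open>y\<close>,
  \<open>z\<close> admits the jump that undoes it.\<close>

lemma (in pair_graph) jump_compl:
  assumes "jump G P Q" "P \<subseteq> pverts G"
  shows "jump G (pverts G - Q) (pverts G - P)"
  using assms(1)
proof cases
  case (1 x y z)
  have "z \<in> pverts G"
    using 1 in_arcsD2 by auto
  then have "pverts G - P = insert z ((pverts G - Q) - {x, y})"
    using 1 by auto
  moreover have "x \<in> pverts G - Q" "y \<in> pverts G - Q" "z \<notin> pverts G - Q"
    using 1 assms(2) by auto
  ultimately show ?thesis
    using 1 jump.intros by metis
qed

lemma (in pair_graph) jumps_compl:
  assumes "(jump G)\<^sup>*\<^sup>* P Q" "P \<subseteq> pverts G"
  shows "(jump G)\<^sup>*\<^sup>* (pverts G - Q) (pverts G - P)"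
  using assms(1)
proof induction
  case base
  show ?case by simp
next
  case (step Q R)
  have "Q \<subseteq> pverts G"
    using step.hyps(1) assms(2) by induction (auto dest: jump_subset)
  then show ?case
    using step jump_compl by (meson converse_rtranclp_into_rtranclp)
qed

section \<open>Reduction to a single peg in a join\<close>

locale join_graph = pair_graph G for G :: "'a pair_pre_digraph" +
  fixes X Y :: "'a set"
  assumes verts_eq: "pverts G = X \<union> Y"
    and disjoint: "X \<inter> Y = {}"
    and cross: "X \<times> Y \<subseteq> parcs G"
    and card_X: "card X \<ge> 2"
    and card_Y: "card Y \<ge> 2"
begin

lemma cross': "Y \<times> X \<subseteq> parcs G"
  using cross arcs_symmetric by auto

text \<open>Since both sides live in one vertex type and edges inside them are left free, results
  for \<open>X\<close> carry over to \<open>Y\<close>.\<close>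

lemma swap: "join_graph G Y X"
  using verts_eq disjoint cross' card_X card_Y by unfold_locales auto

text \<open>Each peg of \<open>Q\<close> is jumped over from a peg of \<open>R\<close> into a hole
  of \<open>X\<close>. Both exist while \<open>R\<close> is nonempty and proper, which persists
  because the jump merely moves one peg within \<open>X\<close>. \<open>Q'\<close> holds the pegs of
  \<open>Y\<close> to be spared.\<close>

lemma jumps_clear:
  assumes "finite Q" "Q \<subseteq> Y" "Q' \<subseteq> Y" "Q \<inter> Q' = {}" "R \<subset> X" "R \<noteq> {}"
  shows "\<exists>R'. R' \<subset> X \<and> card R' = card R \<and> (jump G)\<^sup>*\<^sup>* (R \<union> Q \<union> Q') (R' \<union> Q')"
  using assms
proof (induction Q arbitrary: R rule: finite_induct)
  case empty
  then show ?case by auto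
next
  case (insert y Q)
  have "finite X"
    using card_X card.infinite by fastforce
  then have "finite R"
    using insert.prems finite_subset by blast
  obtain r s where rs: "r \<in> R" "s \<in> X - R"
    using insert.prems by blast
  define R1 where "R1 = insert s (R - {r})"
  have "s \<notin> R - {r}"
    using rs by blast
  then have "card R1 = card R"
    using \<open>finite R\<close> rs(1) card_Suc_Diff1[of R r] by (simp add: R1_def)
  moreover have "r \<notin> R1" "R1 \<subseteq> X" "r \<in> X"
    using rs insert.prems by (auto simp: R1_def)
  ultimately have R1: "R1 \<subset> X" "R1 \<noteq> {}" "card R1 = card R"
    by (auto simp: R1_def)
  have "(r, y) \<in> parcs G" "(y, s) \<in> parcs G" "s \<notin> Y"
    using rs insert.prems cross cross' disjoint by blast+
  then have "jump G (R \<union> insert y Q \<union> Q') (insert s ((R \<union> insert y Q \<union> Q') - {r, y}))"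
    using rs insert.prems by (intro jump.intros) auto
  moreover have "insert s ((R \<union> insert y Q \<union> Q') - {r, y}) = R1 \<union> Q \<union> Q'"
    using rs insert.prems insert.hyps disjoint by (auto simp: R1_def)
  ultimately have "jump G (R \<union> insert y Q \<union> Q') (R1 \<union> Q \<union> Q')"
    by simp
  moreover obtain R' where "R' \<subset> X" "card R' = card R1" "(jump G)\<^sup>*\<^sup>* (R1 \<union> Q \<union> Q') (R' \<union> Q')"
    using insert.IH[of R1] insert.prems R1 by auto
  ultimately show ?case
    using R1(3) by (metis converse_rtranclp_into_rtranclp)
qed

lemma jumps_single_peg:
  assumes "x \<in> X" "Q \<subseteq> Y"
  shows "\<exists>v\<in>X. (jump G)\<^sup>*\<^sup>* (insert x Q) {v}"
proof -
  have "finite Y"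
    using card_Y card.infinite by fastforce
  moreover have "{x} \<subset> X"
    using assms card_X by (auto simp: psubset_eq)
  ultimately obtain R where "R \<subset> X" "card R = 1" "(jump G)\<^sup>*\<^sup>* (insert x Q) R"
    using jumps_clear[of Q "{}" "{x}"] assms finite_subset by auto
  then show ?thesis
    by (auto simp: card_1_singleton_iff)
qed

lemma solvable_side_subset:
  assumes "R \<subset> X" "R \<noteq> {} \<or> (\<exists>u\<in>Y. \<exists>w\<in>Y. (u, w) \<in> parcs G)"
  shows "\<exists>v\<in>X. (jump G)\<^sup>*\<^sup>* (R \<union> Y) {v}"
proof (cases "R = {}")
  case True
  \<comment> \<open>With no peg in \<open>X\<close>, the edge inside \<open>Y\<close> supplies the
    first jump, over \<open>w\<close> to some \<open>x\<close> in \<open>X\<close>; the peg at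
    \<open>x\<close> then clears \<open>Y\<close>.\<close>
  obtain u w where uw: "u \<in> Y" "w \<in> Y" "(u, w) \<in> parcs G"
    using assms True by blast
  obtain x where "x \<in> X"
    using assms(1) by blast
  then have "jump G Y (insert x (Y - {u, w}))"
    using uw cross' disjoint by (intro jump.intros) auto
  moreover obtain v where "v \<in> X" "(jump G)\<^sup>*\<^sup>* (insert x (Y - {u, w})) {v}"
    using jumps_single_peg \<open>x \<in> X\<close> by (metis Diff_subset)
  ultimately show ?thesis
    using True by (metis Un_empty_left converse_rtranclp_into_rtranclp)
next
  case False
  have fin: "finite X"
    using card_X card.infinite by fastforce
  obtain y where y: "y \<in> Y"
    using card_Y by fastforce
  \<comment> \<open>Removing the one peg at \<open>y\<close> opens a hole in the full side
    \<open>Y\<close>. The pegs of \<open>Y - {y}\<close> can then clear all of \<open>R1\<close> but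
    a single \<open>r\<close>, and \<open>r\<close> finally clears \<open>Y\<close>.\<close>
  obtain R1 where R1: "R1 \<subset> X" "card R1 = card R"
      "(jump G)\<^sup>*\<^sup>* (R \<union> {y} \<union> (Y - {y})) (R1 \<union> (Y - {y}))"
    using jumps_clear[of "{y}" "Y - {y}" R] assms False y by auto
  have "R1 \<noteq> {}"
    using R1 False fin assms(1) by (metis card_0_eq card.empty finite_subset psubset_imp_subset)
  then obtain r where r: "r \<in> R1"
    by blast
  have "Y - {y} \<noteq> {}"
    using card_Y card_mono[of "{y}" Y] by auto
  then obtain Q where Q: "Q \<subset> Y" "(jump G)\<^sup>*\<^sup>* (Y - {y} \<union> (R1 - {r}) \<union> {r}) (Q \<union> {r})"
    using join_graph.jumps_clear[OF swap, of "R1 - {r}" "{r}" "Y - {y}"] r R1 y fin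
      finite_subset[of R1 X] by auto
  obtain v where "v \<in> X" "(jump G)\<^sup>*\<^sup>* (insert r Q) {v}"
    using jumps_single_peg[of r Q] r R1 Q by auto
  moreover have "R \<union> {y} \<union> (Y - {y}) = R \<union> Y" "Y - {y} \<union> (R1 - {r}) \<union> {r} = R1 \<union> (Y - {y})"
    "Q \<union> {r} = insert r Q"
    using y r by auto
  ultimately show ?thesis
    using R1 Q by (metis rtranclp_trans)
qed

section \<open>Terminal states and independent sets\<close>

lemma terminal_imp_independent:
  assumes "terminal_state G T"
  shows "independent_set G T"
proof -
  obtain v where "v \<in> pverts G" "(jump G)\<^sup>*\<^sup>* (pverts G - {v}) T"
    using assms by (auto simp: terminal_state_def)
  then have psub: "T \<subset> pverts G"
    using jumps_psubset by blast
  have nbr: "z \<in> T" if "x \<in> T" "y \<in> T" "(x, y) \<in> parcs G" "(y, z) \<in> parcs G" for x y z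
    using that assms jump.intros unfolding terminal_state_def by metis
  have False if xy: "x \<in> T" "y \<in> T" "(x, y) \<in> parcs G" for x y
  proof -
    have yx: "(y, x) \<in> parcs G"
      using xy arcs_symmetric by auto
    \<comment> \<open>By \<open>nbr\<close>, pegs at \<open>x\<close> and \<open>y\<close> force
      pegs on all neighbours of \<open>x\<close>, hence on \<open>Y'\<close>; the edge from
      \<open>x\<close> to any \<open>y'\<close> then forces them on \<open>X'\<close>. Generic sides
      cover both positions of \<open>x\<close>.\<close>
    have *: "x' \<in> T" if "join_graph G X' Y'" "x \<in> X'" "x' \<in> X' \<union> Y'" for X' Y' x'
    proof -
      interpret J: join_graph G X' Y' by fact
      have Y: "Y' \<subseteq> T"
        using nbr[OF xy(2) xy(1) yx] J.cross that by auto
      moreover obtain y' where y': "y' \<in> Y'"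
        using J.card_Y by fastforce
      ultimately have "y' \<in> T" "(x, y') \<in> parcs G"
        using J.cross that by auto
      then have "X' \<subseteq> T"
        using nbr[OF xy(1)] J.cross' y' by blast
      then show ?thesis
        using Y that by auto
    qed
    have "x \<in> X \<or> x \<in> Y"
      using xy psub verts_eq by auto
    then have "pverts G \<subseteq> T"
      using *[OF join_graph_axioms] *[OF swap] verts_eq by auto
    then show False
      using psub by auto
  qed
  then show ?thesis
    using psub by (auto simp: independent_set_def)
qed

lemma independent_side_terminal:
  assumes "independent_set G S" "S \<noteq> {}" "S \<subseteq> X"
    and inner: "\<not> parcs G \<subseteq> X \<times> Y \<union> Y \<times> X"
  shows "terminal_state G S"
proof -
  \<comment> \<open>If \<open>S\<close> is all of \<open>X\<close>, then \<open>X\<close> carries no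
    edge, so the edge that \<open>inner\<close> provides lies inside \<open>Y\<close>.\<close>
  have "X - S \<noteq> {} \<or> (\<exists>u\<in>Y. \<exists>w\<in>Y. (u, w) \<in> parcs G)"
  proof (rule ccontr)
    assume "\<not> ?thesis"
    then have *: "S = X" "\<And>u w. u \<in> Y \<Longrightarrow> w \<in> Y \<Longrightarrow> (u, w) \<notin> parcs G"
      using assms by auto
    have "e \<in> X \<times> Y \<union> Y \<times> X" if "e \<in> parcs G" for e
    proof (cases e)
      case (Pair u w)
      then have "u \<in> X \<union> Y" "w \<in> X \<union> Y"
        using that verts_eq in_arcsD1 in_arcsD2 by auto
      then show ?thesis
        using that Pair * assms(1) by (auto simp: independent_set_def)
    qed
    then show False
      using inner by blast
  qed
  moreover have "X - S \<subset> X"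
    using assms by auto
  ultimately obtain v where v: "v \<in> X" "(jump G)\<^sup>*\<^sup>* (X - S \<union> Y) {v}"
    using solvable_side_subset[of "X - S"] by auto
  have "X - S \<union> Y = pverts G - S" "S \<subseteq> pverts G"
    using verts_eq disjoint assms(3) by auto
  then have "(jump G)\<^sup>*\<^sup>* (pverts G - {v}) S"
    using jumps_compl[OF v(2)] verts_eq by (auto simp: double_diff)
  moreover have "\<not> jump G S P" for P
    using assms(1) by (auto simp: independent_set_def elim: jump.cases)
  ultimately show ?thesis
    using v verts_eq by (auto simp: terminal_state_def)
qed

text \<open>A crossing edge prevents \<open>S\<close> from meeting both sides. The empty set is
  excluded because every jump leaves a peg at \<open>z\<close>.\<close>

lemma independent_imp_terminal:
  assumes "independent_set G S" "S \<noteq> {}" "\<not> parcs G \<subseteq> X \<times> Y \<union> Y \<times> X"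
  shows "terminal_state G S"
proof -
  have "S \<subseteq> X \<or> S \<subseteq> Y"
    using assms(1) verts_eq cross unfolding independent_set_def by blast
  then show ?thesis
    using independent_side_terminal join_graph.independent_side_terminal[OF swap] assms
    by (metis sup_commute)
qed

theorem fools_solitaire_eq_independence:
  assumes "\<not> parcs G \<subseteq> X \<times> Y \<union> Y \<times> X"
  shows "fools_solitaire_number G = independence_number G"
proof -
  let ?T = "{card T |T. terminal_state G T}" and ?I = "{card S |S. independent_set G S}"
  have "?I \<subseteq> card ` Pow (pverts G)"
    by (auto simp: independent_set_def)
  then have fin: "finite ?I"
    by (rule finite_subset) auto
  have sub: "?T \<subseteq> ?I"
    using terminal_imp_independent by auto
  \<comment> \<open>A singleton makes the maximum at least 1, so a largest independent set is
    nonempty and therefore terminal.\<close>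
  obtain x where x: "x \<in> X"
    using card_X by fastforce
  then have "independent_set G {x}"
    using verts_eq by (auto simp: independent_set_def dest: no_loops)
  then have ind1: "1 \<in> ?I"
    by force
  then have "Max ?I \<ge> 1" "Max ?I \<in> ?I"
    using fin Max_ge Max_in by blast+
  then obtain S where S: "independent_set G S" "card S = Max ?I" "S \<noteq> {}"
    by force
  then have "Max ?I \<in> ?T"
    using independent_imp_terminal assms by (metis (mono_tags, lifting) mem_Collect_eq)
  moreover have "t \<le> Max ?I" if "t \<in> ?T" for t
    using that sub fin Max_ge by blast
  ultimately have "Max ?T = Max ?I"
    using finite_subset[OF sub fin] by (intro Max_eqI) auto
  then show ?thesis
    by (simp add: fools_solitaire_number_def independence_number_def)
qed

end

section \<open>Transfer to the join of two graphs\<close>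

lemma join_graph_graph_join:
  assumes "pair_graph G" "pair_graph H" "card (pverts G) \<ge> 2" "card (pverts H) \<ge> 2"
  shows "join_graph (graph_join G H) (Inl ` pverts G) (Inr ` pverts H)"
proof -
  interpret G: pair_graph G by fact
  interpret H: pair_graph H by fact
  show ?thesis
  proof
    show "symmetric (with_proj (graph_join G H))"
      by (auto simp: symmetric_def graph_join_def intro!: symI
          dest: G.arcs_symmetric H.arcs_symmetric intro: rev_image_eqI)
  qed (use assms in \<open>auto simp: graph_join_def card_image Plus_def
      dest: G.no_loops H.no_loops G.in_arcsD1 G.in_arcsD2 H.in_arcsD1 H.in_arcsD2\<close>)
qed

theorem theorem2p2:
  fixes G :: "'a pair_pre_digraph" and H :: "'b pair_pre_digraph"
  assumes "pair_graph G" and "pair_graph H"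
    and "card (pverts G) \<ge> 2" and "card (pverts H) \<ge> 2"
    and "card (edge_set G) + card (edge_set H) \<ge> 1"
  shows "fools_solitaire_number (graph_join G H) = independence_number (graph_join G H)"
proof -
  interpret join_graph "graph_join G H" "Inl ` pverts G" "Inr ` pverts H"
    using join_graph_graph_join assms by blast
  \<comment> \<open>Without arcs both edge sets would have cardinality 0. The image of an arc under
    \<open>Inl\<close> or \<open>Inr\<close> stays inside one side.\<close>
  have "parcs G \<noteq> {} \<or> parcs H \<noteq> {}"
    using assms(5) by (auto simp: edge_set_def)
  then show ?thesis
    by (intro fools_solitaire_eq_independence) (force simp: graph_join_def)
qed

end
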